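(* Let $dWHA$ be the Hopf algebra of substitutions described in the context, and define a bilinear form on $dWHA$ by $\left\langle \binom{\rho}{\sigma},\binom{\rho'}{\sigma'}\right\rangle=1$ if there is a renaming of variables (representing both substitutions with $\mathrm{supp}(\rho)=\mathrm{supp}(\sigma)=\mathrm{supp}(\rho')=\mathrm{supp}(\sigma')$) such that $\rho=\sigma'$ and $\rho'=\sigma$, and $0$ otherwise. Then $dWHA$ is selfdual with respect to this inner product, i.e. for all substitutions $p,p',q$ one has $\langle m(p\otimes p'),q\rangle=\langle p\otimes p',\mu(q)\rangle$, where on the right $\langle a\otimes b,c\otimes d\rangle=\langle a,c\rangle\langle b,d\rangle$.
   Context: Fix an infinite auxiliary alphabet $\mathcal{X}=\{x_1,x_2,\dots\}$. A word is a finite sequence of letters; its support $\mathrm{supp}$ is the set of distinct letters occurring in it; a subword of $[a_1,\dots,a_m]$ is $[a_{i_1},\dots,a_{i_r}]$ with $i_1<\dots<i_r$. A substitution is a pair of words $\binom{\rho}{\sigma}$ over $\mathcal{X}$ with $\mathrm{supp}(\rho)=\mathrm{supp}(\sigma)$, considered up to renaming of letters by a bijection of supports applied simultaneously to $\rho$ and $\sigma$; the empty substitution is included. $dWHA$ is the free Abelian group on substitutions. The shuffle product $\times_{sh}$ of $[a_1,\dots,a_m]$ and $[b_1,\dots,b_n]$ is the sum with multiplicities of all interleavings preserving the order of the $a$'s and of the $b$'s. Multiplication: for $\binom{\rho}{\sigma},\binom{\rho'}{\sigma'}$ written with disjoint supports, the product is $\sum_\gamma\binom{\rho\rho'}{\gamma}$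 over the terms $\gamma$ of $\sigma\times_{sh}\sigma'$ ($\rho\rho'$ = concatenation). A cut $\sigma=\sigma_1\sigma_2$ is good if $\mathrm{supp}(\sigma_1)\cap\mathrm{supp}(\sigma_2)=\emptyset$. For $p=\binom{\rho}{\sigma}$ and a subword $\sigma_1$ of $\sigma$, $p^{-1}(\sigma_1)$ is the subword of $\rho$ consisting of all letters of $\rho$ in $\mathrm{supp}(\sigma_1)$. Comultiplication: $\mu\binom{\rho}{\sigma}=\sum\binom{p^{-1}(\sigma_1)}{\sigma_1}\otimes\binom{p^{-1}(\sigma_2)}{\sigma_2}$ over all good cuts $\sigma=\sigma_1\sigma_2$. The unit is the empty substitution; the counit is $1$ on the empty substitution and $0$ on others. *)

theory Defs
  imports "HOL-Library.Poly_Mapping" "HOL-Library.Multiset"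
begin

section \<open>Words and shuffles\<close>

text \<open>The letter \<open>x\<^sub>i\<close> of the infinite alphabet is represented by the natural number \<open>i\<close>; the
  support of a word \<open>w\<close> is \<^term>\<open>set w\<close>.\<close>

type_synonym letter = nat

text \<open>Unlike \<^const>\<open>shuffles\<close>, which is a set, this keeps multiplicities.\<close>

fun shuffle_product :: "'a list \<Rightarrow> 'a list \<Rightarrow> 'a list multiset" where
  "shuffle_product [] ys = {#ys#}"
| "shuffle_product xs [] = {#xs#}"
| "shuffle_product (x # xs) (y # ys) =
     image_mset ((#) x) (shuffle_product xs (y # ys)) +
     image_mset ((#) y) (shuffle_product (x # xs) ys)"

lemma set_mset_shuffle_product: "set_mset (shuffle_product xs ys) = shuffles xs ys"
  by (induction xs ys rule: shuffle_product.induct) auto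

lemma shuffle_product_map:
  "shuffle_product (map f xs) (map f ys) = image_mset (map f) (shuffle_product xs ys)"
  by (induction xs ys rule: shuffle_product.induct)
    (simp_all add: image_mset.compositionality comp_def)

definition good_cuts :: "'a list \<Rightarrow> ('a list \<times> 'a list) set" where
  "good_cuts \<sigma> = {(\<sigma>\<^sub>1, \<sigma>\<^sub>2). \<sigma> = \<sigma>\<^sub>1 @ \<sigma>\<^sub>2 \<and> set \<sigma>\<^sub>1 \<inter> set \<sigma>\<^sub>2 = {}}"

lemma finite_good_cuts [simp]: "finite (good_cuts \<sigma>)"
proof (rule finite_subset)
  show "good_cuts \<sigma> \<subseteq> (\<lambda>i. (take i \<sigma>, drop i \<sigma>)) ` {..length \<sigma>}"
  proof
    fix c assume "c \<in> good_cuts \<sigma>"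
    then obtain s t where "c = (s, t)" "\<sigma> = s @ t"
      by (auto simp: good_cuts_def)
    then show "c \<in> (\<lambda>i. (take i \<sigma>, drop i \<sigma>)) ` {..length \<sigma>}"
      by (intro image_eqI[of _ _ "length s"]) auto
  qed
qed simp

lemma good_cuts_map:
  assumes "inj_on f (set \<sigma>)"
  shows "good_cuts (map f \<sigma>) = map_prod (map f) (map f) ` good_cuts \<sigma>"
proof (intro equalityI subsetI)
  fix c assume "c \<in> good_cuts (map f \<sigma>)"
  then obtain s t where c: "c = (s, t)" "map f \<sigma> = s @ t" "set s \<inter> set t = {}"
    by (auto simp: good_cuts_def)
  then obtain s' t' where st: "\<sigma> = s' @ t'" "s = map f s'" "t = map f t'"
    by (auto simp: map_eq_append_conv)
  then have "set s' \<inter> set t' = {}"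
    using c(3) by auto
  then have "(s', t') \<in> good_cuts \<sigma>"
    using st by (simp add: good_cuts_def)
  then show "c \<in> map_prod (map f) (map f) ` good_cuts \<sigma>"
    using c(1) st by force
next
  fix c assume "c \<in> map_prod (map f) (map f) ` good_cuts \<sigma>"
  then obtain s t where c: "c = (map f s, map f t)" "\<sigma> = s @ t" "set s \<inter> set t = {}"
    by (auto simp: good_cuts_def)
  have "f ` set s \<inter> f ` set t = f ` (set s \<inter> set t)"
    by (rule inj_on_image_Int[symmetric, OF assms]) (auto simp: c(2))
  then show "c \<in> good_cuts (map f \<sigma>)"
    using c by (simp add: good_cuts_def)
qed

section \<open>Substitutions\<close>

definition renaming :: "letter list \<times> letter list \<Rightarrow> letter list \<times> letter list \<Rightarrow> bool" where
  "renaming = (\<lambda>(\<rho>, \<sigma>) (\<rho>', \<sigma>'). set \<rho> = set \<sigma> \<and> set \<rho>' = set \<sigma>' \<and>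
     (\<exists>f. bij_betw f (set \<rho>) (set \<rho>') \<and> \<rho>' = map f \<rho> \<and> \<sigma>' = map f \<sigma>))"

lemma renamingE:
  assumes "renaming (\<rho>, \<sigma>) (\<rho>', \<sigma>')"
  obtains f where "set \<rho> = set \<sigma>" "inj_on f (set \<sigma>)" "\<rho>' = map f \<rho>" "\<sigma>' = map f \<sigma>"
  using assms by (auto simp: renaming_def bij_betw_def)

lemma renamingI:
  "set \<rho> = set \<sigma> \<Longrightarrow> inj_on f (set \<sigma>) \<Longrightarrow> renaming (\<rho>, \<sigma>) (map f \<rho>, map f \<sigma>)"
  by (auto simp: renaming_def bij_betw_def intro!: exI[of _ f])

text \<open>A partial quotient: only pairs of words with equal supports represent substitutions.\<close>

quotient_type subst = "letter list \<times> letter list" / partial: renaming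
proof (rule part_equivpI)
  show "\<exists>p. renaming p p"
    by (rule exI[of _ "([], [])"]) (simp add: renaming_def bij_betw_def)
  show "symp renaming"
  proof (rule sympI)
    fix p q :: "letter list \<times> letter list"
    assume pq: "renaming p q"
    obtain \<rho> \<sigma> \<rho>' \<sigma>' where *: "p = (\<rho>, \<sigma>)" "q = (\<rho>', \<sigma>')"
      by fastforce
    obtain f where f: "set \<rho> = set \<sigma>" "inj_on f (set \<sigma>)" "\<rho>' = map f \<rho>" "\<sigma>' = map f \<sigma>"
      using pq[unfolded *] by (elim renamingE)
    let ?g = "inv_into (set \<sigma>) f"
    have "map ?g \<rho>' = \<rho>" "map ?g \<sigma>' = \<sigma>"
      using f by (auto intro!: map_idI)
    moreover have "inj_on ?g (set \<sigma>')"
      using f by (auto intro: inj_on_inv_into)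
    moreover have "set \<rho>' = set \<sigma>'"
      using f by simp
    ultimately show "renaming q p"
      using renamingI[of \<rho>' \<sigma>' ?g] * by simp
  qed
  show "transp renaming"
  proof (rule transpI)
    fix p q r :: "letter list \<times> letter list"
    assume pq: "renaming p q" and qr: "renaming q r"
    obtain \<rho> \<sigma> \<rho>' \<sigma>' \<rho>'' \<sigma>'' where *: "p = (\<rho>, \<sigma>)" "q = (\<rho>', \<sigma>')" "r = (\<rho>'', \<sigma>'')"
      by (metis surj_pair)
    obtain f where f: "set \<rho> = set \<sigma>" "inj_on f (set \<sigma>)" "\<rho>' = map f \<rho>" "\<sigma>' = map f \<sigma>"
      using pq[unfolded *] by (elim renamingE)
    obtain g where g: "inj_on g (set \<sigma>')" "\<rho>'' = map g \<rho>'" "\<sigma>'' = map g \<sigma>'"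
      using qr[unfolded *] by (elim renamingE)
    have "inj_on (g \<circ> f) (set \<sigma>)"
      using f g by (auto intro: comp_inj_on)
    then show "renaming p r"
      using renamingI[of \<rho> \<sigma> "g \<circ> f"] f g * by simp
  qed
qed

text \<open>Meaningful only if the two words have the same support.\<close>

definition Subst :: "letter list \<Rightarrow> letter list \<Rightarrow> subst" where
  "Subst \<rho> \<sigma> = abs_subst (\<rho>, \<sigma>)"

lemma Subst_eq_iff:
  assumes "set \<rho> = set \<sigma>" "set \<rho>' = set \<sigma>'"
  shows "Subst \<rho> \<sigma> = Subst \<rho>' \<sigma>' \<longleftrightarrow> renaming (\<rho>, \<sigma>) (\<rho>', \<sigma>')"
proof -
  have "renaming (\<rho>, \<sigma>) (\<rho>, \<sigma>)" "renaming (\<rho>', \<sigma>') (\<rho>', \<sigma>')"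
    using assms renamingI[of _ _ id] by auto
  then show ?thesis
    using Quotient_rel[OF Quotient_subst] unfolding Subst_def by metis
qed

lemma Subst_map:
  assumes "set \<rho> = set \<sigma>" "inj_on f (set \<sigma>)"
  shows "Subst (map f \<rho>) (map f \<sigma>) = Subst \<rho> \<sigma>"
  using Subst_eq_iff[of \<rho> \<sigma> "map f \<rho>" "map f \<sigma>"] renamingI[OF assms] assms(1) by auto

lemma subst_cases:
  obtains \<rho> \<sigma> where "set \<rho> = set \<sigma>" "p = Subst \<rho> \<sigma>"
proof -
  obtain x where x: "renaming x x" "p = abs_subst x"
    using Quotient_subst by (metis Quotient_abs_rep Quotient_rep_reflp)
  obtain \<rho> \<sigma> where "x = (\<rho>, \<sigma>)"
    by fastforce
  then show thesis
    using x that[of \<rho> \<sigma>] by (auto simp: Subst_def renaming_def)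
qed

section \<open>The Hopf algebra\<close>

text \<open>The free Abelian group on substitutions, with \<^term>\<open>frag_of p\<close> as the basis element given
  by \<open>p\<close>; the tensor square of a free Abelian group is free on the pairs of basis elements.\<close>

type_synonym dWHA = "subst \<Rightarrow>\<^sub>0 int"
type_synonym dWHA2 = "subst \<times> subst \<Rightarrow>\<^sub>0 int"

definition tensor :: "('a \<Rightarrow>\<^sub>0 int) \<Rightarrow> ('b \<Rightarrow>\<^sub>0 int) \<Rightarrow> ('a \<times> 'b \<Rightarrow>\<^sub>0 int)" where
  "tensor x y = frag_extend (\<lambda>a. frag_extend (\<lambda>b. frag_of (a, b)) y) x"

definition mult_words ::
    "letter list \<times> letter list \<Rightarrow> letter list \<times> letter list \<Rightarrow> dWHA" where
  "mult_words = (\<lambda>(\<rho>, \<sigma>) (\<rho>', \<sigma>'). \<Sum>\<gamma>\<in>#shuffle_product \<sigma> \<sigma>'. frag_of (Subst (\<rho> @ \<rho>') \<gamma>))"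

lemma mult_words_map:
  assumes "set \<rho> = set \<sigma>" "set \<rho>' = set \<sigma>'" "inj_on f (set \<sigma> \<union> set \<sigma>')"
  shows "mult_words (map f \<rho>, map f \<sigma>) (map f \<rho>', map f \<sigma>') = mult_words (\<rho>, \<sigma>) (\<rho>', \<sigma>')"
proof -
  have "Subst (map f \<rho> @ map f \<rho>') (map f \<gamma>) = Subst (\<rho> @ \<rho>') \<gamma>"
    if "\<gamma> \<in># shuffle_product \<sigma> \<sigma>'" for \<gamma>
  proof -
    have "set \<gamma> = set \<sigma> \<union> set \<sigma>'"
      using that by (simp add: set_mset_shuffle_product set_shuffles)
    then show ?thesis
      using Subst_map[of "\<rho> @ \<rho>'" \<gamma> f] assms by simp
  qed
  then show ?thesis
    unfolding mult_words_def shuffle_product_map prod.case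
    by (auto simp: image_mset.compositionality intro!: arg_cong[of _ _ sum_mset] image_mset_cong)
qed

lemma mult_words_cong:
  assumes "renaming (\<rho>, \<sigma>) (\<alpha>, \<beta>)" "renaming (\<rho>', \<sigma>') (\<alpha>', \<beta>')"
    and disj: "set \<sigma> \<inter> set \<sigma>' = {}" "set \<beta> \<inter> set \<beta>' = {}"
  shows "mult_words (\<rho>, \<sigma>) (\<rho>', \<sigma>') = mult_words (\<alpha>, \<beta>) (\<alpha>', \<beta>')"
proof -
  obtain f where f: "set \<rho> = set \<sigma>" "inj_on f (set \<sigma>)" "\<alpha> = map f \<rho>" "\<beta> = map f \<sigma>"
    using assms(1) by (elim renamingE)
  obtain g where g: "set \<rho>' = set \<sigma>'" "inj_on g (set \<sigma>')" "\<alpha>' = map g \<rho>'" "\<beta>' = map g \<sigma>'"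
    using assms(2) by (elim renamingE)
  define h where "h a = (if a \<in> set \<sigma> then f a else g a)" for a
  have h1: "h a = f a" if "a \<in> set \<sigma>" for a
    using that by (simp add: h_def)
  have h2: "h a = g a" if "a \<in> set \<sigma>'" for a
    using that disj(1) by (auto simp: h_def)
  have maps: "map h \<rho> = \<alpha>" "map h \<sigma> = \<beta>" "map h \<rho>' = \<alpha>'" "map h \<sigma>' = \<beta>'"
    using f g h1 h2 by auto
  have "inj_on h (set \<sigma>)" "inj_on h (set \<sigma>')"
    using f(2) g(2) h1 h2 by (simp_all cong: inj_on_cong)
  moreover have "h ` set \<sigma> \<inter> h ` set \<sigma>' = {}"
    using disj(2) maps by (metis list.set_map)
  ultimately have "inj_on h (set \<sigma> \<union> set \<sigma>')"
    by (auto simp: inj_on_Un)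
  then show ?thesis
    using mult_words_map[of \<rho> \<sigma> \<rho>' \<sigma>' h] f(1) g(1) maps by simp
qed

text \<open>Renaming the letters of the first factor to even numbers and those of the second factor to
  odd numbers makes the supports disjoint; by \<open>mult_basis_Subst\<close> below, every choice of
  representatives with disjoint supports gives the same product.\<close>

lift_definition mult_basis :: "subst \<Rightarrow> subst \<Rightarrow> dWHA" is
  "\<lambda>(\<rho>, \<sigma>) (\<rho>', \<sigma>').
     mult_words (map (\<lambda>n. 2 * n) \<rho>, map (\<lambda>n. 2 * n) \<sigma>)
                (map (\<lambda>n. 2 * n + 1) \<rho>', map (\<lambda>n. 2 * n + 1) \<sigma>')"
proof -
  fix p q p' q' :: "letter list \<times> letter list"
  assume pq: "renaming p q" "renaming p' q'"
  obtain \<rho> \<sigma> \<rho>' \<sigma>' \<alpha> \<beta> \<alpha>' \<beta>' where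
    *: "p = (\<rho>, \<sigma>)" "p' = (\<rho>', \<sigma>')" "q = (\<alpha>, \<beta>)" "q' = (\<alpha>', \<beta>')"
    by (metis surj_pair)
  have ren: "renaming (map h \<rho>, map h \<sigma>) (map h \<alpha>, map h \<beta>)"
    if h: "inj h" and r: "renaming (\<rho>, \<sigma>) (\<alpha>, \<beta>)" for h and \<rho> \<sigma> \<alpha> \<beta> :: "letter list"
  proof -
    obtain f where f: "set \<rho> = set \<sigma>" "inj_on f (set \<sigma>)" "\<alpha> = map f \<rho>" "\<beta> = map f \<sigma>"
      using r by (elim renamingE)
    have "inj_on (h \<circ> f \<circ> inv h) (set (map h \<sigma>))"
      using h f(2) by (auto simp: inj_on_def)
    from renamingI[OF _ this, of "map h \<rho>"] show ?thesis
      using f h by (simp add: comp_def)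
  qed
  have "inj (\<lambda>n::nat. 2 * n)" "inj (\<lambda>n::nat. 2 * n + 1)"
    by (auto simp: inj_on_def)
  moreover have "(\<lambda>n::nat. 2 * n) ` A \<inter> (\<lambda>n. 2 * n + 1) ` B = {}" for A B
    by (auto; presburger)
  ultimately show
    "(case p of (\<rho>, \<sigma>) \<Rightarrow> \<lambda>(\<rho>', \<sigma>').
       mult_words (map (\<lambda>n. 2 * n) \<rho>, map (\<lambda>n. 2 * n) \<sigma>)
                  (map (\<lambda>n. 2 * n + 1) \<rho>', map (\<lambda>n. 2 * n + 1) \<sigma>')) p' =
     (case q of (\<rho>, \<sigma>) \<Rightarrow> \<lambda>(\<rho>', \<sigma>').
       mult_words (map (\<lambda>n. 2 * n) \<rho>, map (\<lambda>n. 2 * n) \<sigma>)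
                  (map (\<lambda>n. 2 * n + 1) \<rho>', map (\<lambda>n. 2 * n + 1) \<sigma>')) q'"
    using pq unfolding * prod.case by (intro mult_words_cong ren) simp_all
qed

lemma mult_basis_Subst:
  assumes "set \<rho> = set \<sigma>" "set \<rho>' = set \<sigma>'" "set \<sigma> \<inter> set \<sigma>' = {}"
  shows "mult_basis (Subst \<rho> \<sigma>) (Subst \<rho>' \<sigma>') =
           (\<Sum>\<gamma>\<in>#shuffle_product \<sigma> \<sigma>'. frag_of (Subst (\<rho> @ \<rho>') \<gamma>))"
proof -
  have refl: "renaming (\<rho>, \<sigma>) (\<rho>, \<sigma>)" "renaming (\<rho>', \<sigma>') (\<rho>', \<sigma>')"
    using assms(1,2) renamingI[of _ _ id] by auto
  have "mult_basis (Subst \<rho> \<sigma>) (Subst \<rho>' \<sigma>') =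
     mult_words (map (\<lambda>n. 2 * n) \<rho>, map (\<lambda>n. 2 * n) \<sigma>)
                (map (\<lambda>n. 2 * n + 1) \<rho>', map (\<lambda>n. 2 * n + 1) \<sigma>')"
    unfolding Subst_def by (subst mult_basis.abs_eq) (use refl in \<open>simp_all add: eq_onp_def\<close>)
  also have "\<dots> = mult_words (\<rho>, \<sigma>) (\<rho>', \<sigma>')"
  proof (rule mult_words_cong[symmetric])
    show "renaming (\<rho>, \<sigma>) (map (\<lambda>n. 2 * n) \<rho>, map (\<lambda>n. 2 * n) \<sigma>)"
      using assms(1) by (intro renamingI) (auto simp: inj_on_def)
    show "renaming (\<rho>', \<sigma>') (map (\<lambda>n. 2 * n + 1) \<rho>', map (\<lambda>n. 2 * n + 1) \<sigma>')"
      using assms(2) by (intro renamingI) (auto simp: inj_on_def)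
    show "set (map (\<lambda>n. 2 * n) \<sigma>) \<inter> set (map (\<lambda>n. 2 * n + 1) \<sigma>') = {}"
      by (auto; presburger)
  qed (rule assms(3))
  finally show ?thesis
    by (simp add: mult_words_def)
qed

text \<open>The word \<open>p\<^sup>-\<^sup>1(\<sigma>\<^sub>1)\<close> for a substitution \<open>p\<close> with upper word \<open>\<rho>\<close>.\<close>

definition preim :: "letter list \<Rightarrow> letter list \<Rightarrow> letter list" where
  "preim \<rho> \<sigma>\<^sub>1 = filter (\<lambda>a. a \<in> set \<sigma>\<^sub>1) \<rho>"

lift_definition comult_basis :: "subst \<Rightarrow> dWHA2" is
  "\<lambda>(\<rho>, \<sigma>). \<Sum>(\<sigma>\<^sub>1, \<sigma>\<^sub>2)\<in>good_cuts \<sigma>.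
     frag_of (Subst (preim \<rho> \<sigma>\<^sub>1) \<sigma>\<^sub>1, Subst (preim \<rho> \<sigma>\<^sub>2) \<sigma>\<^sub>2)"
proof -
  fix p q :: "letter list \<times> letter list"
  assume pq: "renaming p q"
  obtain \<rho> \<sigma> \<rho>' \<sigma>' where *: "p = (\<rho>, \<sigma>)" "q = (\<rho>', \<sigma>')"
    by (metis surj_pair)
  obtain f where f: "set \<rho> = set \<sigma>" "inj_on f (set \<sigma>)" "\<rho>' = map f \<rho>" "\<sigma>' = map f \<sigma>"
    using pq[unfolded *] by (elim renamingE)
  have S: "Subst (preim \<rho>' (map f s)) (map f s) = Subst (preim \<rho> s) s" if "set s \<subseteq> set \<sigma>" for s
  proof -
    have "preim \<rho>' (map f s) = map f (preim \<rho> s)"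
      unfolding preim_def f(3) filter_map
      by (intro arg_cong[of _ _ "map f"] filter_cong refl)
        (use f(1) inj_on_image_mem_iff[OF f(2)] that in auto)
    moreover have "set (preim \<rho> s) = set s"
      using that f(1) by (auto simp: preim_def)
    moreover have "inj_on f (set s)"
      using f(2) that by (rule inj_on_subset)
    ultimately show ?thesis
      by (simp add: Subst_map)
  qed
  have sub: "set s \<subseteq> set \<sigma>" "set t \<subseteq> set \<sigma>" if "(s, t) \<in> good_cuts \<sigma>" for s t
    using that by (auto simp: good_cuts_def)
  have inj: "inj_on (map_prod (map f) (map f)) (good_cuts \<sigma>)"
  proof (rule inj_onI)
    fix c d assume cd: "c \<in> good_cuts \<sigma>" "d \<in> good_cuts \<sigma>"
      "map_prod (map f) (map f) c = map_prod (map f) (map f) d"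
    obtain s t s' t' where st: "c = (s, t)" "d = (s', t')"
      by (metis surj_pair)
    have "length s = length s'"
      using cd(3) by (auto simp: st dest: map_eq_imp_length_eq)
    then show "c = d"
      using cd(1,2) by (auto simp: st good_cuts_def)
  qed
  have "(\<Sum>(s, t)\<in>good_cuts \<sigma>'. frag_of (Subst (preim \<rho>' s) s, Subst (preim \<rho>' t) t)) =
        (\<Sum>(s, t)\<in>good_cuts \<sigma>. frag_of (Subst (preim \<rho> s) s, Subst (preim \<rho> t) t))"
    unfolding f(4) good_cuts_map[OF f(2)] sum.reindex[OF inj]
    by (rule sum.cong) (auto simp: S sub)
  then show "(case p of (\<rho>, \<sigma>) \<Rightarrow> \<Sum>(s, t)\<in>good_cuts \<sigma>.
        frag_of (Subst (preim \<rho> s) s, Subst (preim \<rho> t) t)) =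
      (case q of (\<rho>, \<sigma>) \<Rightarrow> \<Sum>(s, t)\<in>good_cuts \<sigma>.
        frag_of (Subst (preim \<rho> s) s, Subst (preim \<rho> t) t))"
    by (simp add: *)
qed

lemma comult_basis_Subst:
  assumes "set \<rho> = set \<sigma>"
  shows "comult_basis (Subst \<rho> \<sigma>) = (\<Sum>(\<sigma>\<^sub>1, \<sigma>\<^sub>2)\<in>good_cuts \<sigma>.
           frag_of (Subst (preim \<rho> \<sigma>\<^sub>1) \<sigma>\<^sub>1, Subst (preim \<rho> \<sigma>\<^sub>2) \<sigma>\<^sub>2))"
proof -
  have "renaming (\<rho>, \<sigma>) (\<rho>, \<sigma>)"
    using assms renamingI[of \<rho> \<sigma> id] by auto
  then show ?thesis
    unfolding Subst_def[of \<rho> \<sigma>] by (subst comult_basis.abs_eq) (simp_all add: eq_onp_def)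
qed

definition dWHA_mult :: "dWHA2 \<Rightarrow> dWHA" where
  "dWHA_mult = frag_extend (\<lambda>(p, q). mult_basis p q)"

definition dWHA_comult :: "dWHA \<Rightarrow> dWHA2" where
  "dWHA_comult = frag_extend comult_basis"

section \<open>The inner product\<close>

definition bilinear_extend ::
    "('a \<Rightarrow> 'b \<Rightarrow> int) \<Rightarrow> ('a \<Rightarrow>\<^sub>0 int) \<Rightarrow> ('b \<Rightarrow>\<^sub>0 int) \<Rightarrow> int" where
  "bilinear_extend B x y = (\<Sum>a\<in>Poly_Mapping.keys x. \<Sum>b\<in>Poly_Mapping.keys y.
     Poly_Mapping.lookup x a * Poly_Mapping.lookup y b * B a b)"

definition form_basis :: "subst \<Rightarrow> subst \<Rightarrow> int" where
  "form_basis p q =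
     (if \<exists>\<rho> \<sigma> \<rho>' \<sigma>'. p = Subst \<rho> \<sigma> \<and> q = Subst \<rho>' \<sigma>' \<and>
           set \<rho> = set \<sigma> \<and> set \<sigma> = set \<rho>' \<and> set \<rho>' = set \<sigma>' \<and> \<rho> = \<sigma>' \<and> \<rho>' = \<sigma>
      then 1 else 0)"

definition dWHA_form :: "dWHA \<Rightarrow> dWHA \<Rightarrow> int" where
  "dWHA_form = bilinear_extend form_basis"

definition dWHA2_form :: "dWHA2 \<Rightarrow> dWHA2 \<Rightarrow> int" where
  "dWHA2_form = bilinear_extend (\<lambda>(a, b) (c, d). form_basis a c * form_basis b d)"

end

theory Submission
  imports Defs
begin

text \<open>A renaming \<open>f\<close> that identifies a term \<open>(\<rho>\<rho>', \<gamma>)\<close> of the product with the transpose of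
  \<open>q = (\<alpha>, \<beta>)\<close> is determined on all letters by \<open>map f (\<rho>\<rho>') = \<beta>\<close>. Hence at most one \<open>\<gamma>\<close>
  contributes, and, since the supports of the factors are disjoint, it is contained in the shuffle
  product only once. Cutting \<open>\<beta>\<close> after \<open>|\<rho>|\<close> letters is then a good cut, and it is the only cut
  that can contribute on the other side. So both sides are \<open>0\<close> or \<open>1\<close>, and a contributing \<open>\<gamma>\<close> and a
  contributing cut determine each other, because \<open>\<alpha>\<close> is a shuffle of its restrictions to the
  supports of the two parts of the cut.\<close>

section \<open>Bilinear extensions\<close>

text \<open>Keys can cancel in a sum, so additivity is proved by summing over one finite set that
  contains the keys of all elements involved; the extra terms have coefficient 0.\<close>

lemma bilinear_extend_superset:
  assumes "finite A" "finite B" "Poly_Mapping.keys x \<subseteq> A" "Poly_Mapping.keys y \<subseteq> B"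
  shows "bilinear_extend F x y =
    (\<Sum>a\<in>A. \<Sum>b\<in>B. Poly_Mapping.lookup x a * Poly_Mapping.lookup y b * F a b)"
proof -
  have "(\<Sum>b\<in>Poly_Mapping.keys y. Poly_Mapping.lookup x a * Poly_Mapping.lookup y b * F a b) =
      (\<Sum>b\<in>B. Poly_Mapping.lookup x a * Poly_Mapping.lookup y b * F a b)" for a
    using assms by (intro sum.mono_neutral_left) (auto simp: in_keys_iff)
  then show ?thesis
    unfolding bilinear_extend_def
    using assms by (simp, intro sum.mono_neutral_left) (auto simp: in_keys_iff)
qed

lemma bilinear_extend_add_left:
  "bilinear_extend F (x + x') y = bilinear_extend F x y + bilinear_extend F x' y"
proof -
  let ?A = "Poly_Mapping.keys x \<union> Poly_Mapping.keys x'"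
  have "Poly_Mapping.keys (x + x') \<subseteq> ?A"
    by (rule Poly_Mapping.keys_add)
  then show ?thesis
    by (simp add: bilinear_extend_superset[of ?A "Poly_Mapping.keys y"] lookup_add
        sum.distrib algebra_simps)
qed

lemma bilinear_extend_add_right:
  "bilinear_extend F x (y + y') = bilinear_extend F x y + bilinear_extend F x y'"
proof -
  let ?B = "Poly_Mapping.keys y \<union> Poly_Mapping.keys y'"
  have "Poly_Mapping.keys (y + y') \<subseteq> ?B"
    by (rule Poly_Mapping.keys_add)
  then show ?thesis
    by (simp add: bilinear_extend_superset[of "Poly_Mapping.keys x" ?B] lookup_add
        sum.distrib algebra_simps)
qed

lemma bilinear_extend_zero [simp]:
  "bilinear_extend F 0 y = 0" "bilinear_extend F x 0 = 0"
  by (simp_all add: bilinear_extend_def)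

lemma bilinear_extend_sum_left:
  "bilinear_extend F (\<Sum>i\<in>I. g i) y = (\<Sum>i\<in>I. bilinear_extend F (g i) y)"
  by (induction I rule: infinite_finite_induct) (simp_all add: bilinear_extend_add_left)

lemma bilinear_extend_sum_right:
  "bilinear_extend F x (\<Sum>i\<in>I. g i) = (\<Sum>i\<in>I. bilinear_extend F x (g i))"
  by (induction I rule: infinite_finite_induct) (simp_all add: bilinear_extend_add_right)

lemma bilinear_extend_frag_of [simp]:
  "bilinear_extend F (frag_of a) (frag_of b) = F a b"
  by (simp add: bilinear_extend_def)

section \<open>Shuffles of words with disjoint supports\<close>

lemma count_image_Cons:
  "count (image_mset ((#) x) M) zs =
    (case zs of [] \<Rightarrow> 0 | z # zs' \<Rightarrow> if x = z then count M zs' else 0)"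
  by (induction M) (auto split: list.splits)

text \<open>The two summands of the recursion consist of words starting with \<open>x\<close> and
  \<open>y\<close>. Disjointness gives \<open>x \<noteq> y\<close>, so a given word occurs in at
  most one summand, and the induction hypothesis bounds it there.\<close>

lemma count_shuffle_product_le_1:
  assumes "set xs \<inter> set ys = {}"
  shows "count (shuffle_product xs ys) zs \<le> 1"
  using assms
proof (induction xs ys arbitrary: zs rule: shuffle_product.induct)
  case (3 x xs y ys)
  then show ?case
    by (auto simp: count_image_Cons split: list.splits)
qed simp_all

lemma shuffle_product_disjoint:
  assumes "set xs \<inter> set ys = {}"
  shows "shuffle_product xs ys = mset_set (shuffles xs ys)"
proof (rule multiset_eqI)
  fix zs
  have "count (shuffle_product xs ys) zs = 0 \<longleftrightarrow> zs \<notin> shuffles xs ys"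
    by (simp add: count_eq_zero_iff flip: set_mset_shuffle_product)
  then show "count (shuffle_product xs ys) zs = count (mset_set (shuffles xs ys)) zs"
    using count_shuffle_product_le_1[OF assms, of zs]
    by (auto simp: count_mset_set' le_Suc_eq count_eq_zero_iff)
qed

section \<open>Selfduality\<close>

text \<open>Provides the representatives for which \<open>mult_basis_Subst\<close> computes the
  product.\<close>

lemma disjoint_representatives:
  obtains \<rho> \<sigma> \<rho>' \<sigma>' where "set \<rho> = set \<sigma>" "set \<rho>' = set \<sigma>'" "set \<sigma> \<inter> set \<sigma>' = {}"
    "p = Subst \<rho> \<sigma>" "p' = Subst \<rho>' \<sigma>'"
proof -
  obtain \<rho> \<sigma> where p: "set \<rho> = set \<sigma>" "p = Subst \<rho> \<sigma>"
    by (rule subst_cases)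
  obtain \<rho>' \<sigma>' where p': "set \<rho>' = set \<sigma>'" "p' = Subst \<rho>' \<sigma>'"
    by (rule subst_cases)
  \<comment> \<open>Shifts every letter beyond all letters of \<sigma>; \<open>insert 0\<close>
    keeps \<open>Max\<close> defined when \<sigma> is empty.\<close>
  define f where "f n = n + Suc (Max (insert 0 (set \<sigma>)))" for n :: nat
  have "a \<le> Max (insert 0 (set \<sigma>))" if "a \<in> set \<sigma>" for a
    using that by simp
  then have "set \<sigma> \<inter> f ` set \<sigma>' = {}"
    by (fastforce simp: f_def)
  moreover have "inj_on f (set \<sigma>')"
    by (simp add: f_def inj_on_def)
  ultimately show thesis
    using p p' by (intro that[of \<rho> \<sigma> "map f \<rho>'" "map f \<sigma>'"]) (simp_all add: Subst_map)
qed

text \<open>Any witnesses in \<open>form_basis\<close> differ from the chosen representative of the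
  second argument by a renaming, which also renames the transposed pair. So the form tests equality
  with the transpose.\<close>

lemma form_basis_Subst:
  assumes "set \<alpha> = set \<beta>"
  shows "form_basis p (Subst \<alpha> \<beta>) = (if p = Subst \<beta> \<alpha> then 1 else 0)"
proof -
  have "p = Subst \<beta> \<alpha>"
    if "p = Subst \<rho> \<sigma>" "Subst \<alpha> \<beta> = Subst \<sigma> \<rho>" "set \<rho> = set \<sigma>" for \<rho> \<sigma>
  proof -
    from that assms have "renaming (\<alpha>, \<beta>) (\<sigma>, \<rho>)"
      by (simp add: Subst_eq_iff)
    then obtain f where "inj_on f (set \<beta>)" "\<sigma> = map f \<alpha>" "\<rho> = map f \<beta>"
      by (elim renamingE)
    then show ?thesis
      using that assms by (simp add: Subst_map)
  qed
  then show ?thesis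
    using assms unfolding form_basis_def by (smt (verit))
qed

lemma Subst_eqE:
  assumes "Subst \<rho> \<sigma> = Subst \<rho>' \<sigma>'" "set \<rho> = set \<sigma>" "set \<rho>' = set \<sigma>'"
  obtains f where "inj_on f (set \<sigma>)" "\<rho>' = map f \<rho>" "\<sigma>' = map f \<sigma>"
  using assms by (auto simp: Subst_eq_iff elim: renamingE)

text \<open>Applied to the shuffles and to the good cuts, this reduces the equality of two sums to
  the equivalence of two existence statements.\<close>

lemma sum_unique_indicator:
  assumes "finite A" "\<And>x y. x \<in> A \<Longrightarrow> y \<in> A \<Longrightarrow> P x \<Longrightarrow> P y \<Longrightarrow> x = y"
  shows "(\<Sum>x\<in>A. if P x then 1 else 0 :: int) = (if \<exists>x\<in>A. P x then 1 else 0)"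
proof (cases "\<exists>x\<in>A. P x")
  case True
  then obtain x where x: "x \<in> A" "P x"
    by blast
  then have "(\<Sum>y\<in>A. if P y then 1 else 0 :: int) = (\<Sum>y\<in>A. if y = x then 1 else 0)"
    using assms(2) by (intro sum.cong) auto
  then show ?thesis
    using x assms(1) by auto
qed simp

lemma set_preim: "set s \<subseteq> set \<alpha> \<Longrightarrow> set (preim \<alpha> s) = set s"
  by (auto simp: preim_def)

lemma shuffles_map: "shuffles (map f xs) (map f ys) = map f ` shuffles xs ys"
  by (simp add: shuffle_product_map flip: set_mset_shuffle_product)

lemma contributing_shuffle_unique:
  assumes "Subst \<rho> \<gamma> = Subst \<beta> \<alpha>" "Subst \<rho> \<gamma>' = Subst \<beta> \<alpha>"
    and "set \<rho> = set \<gamma>" "set \<rho> = set \<gamma>'" "set \<beta> = set \<alpha>"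
  shows "\<gamma> = \<gamma>'"
proof -
  obtain f where f: "inj_on f (set \<gamma>)" "\<beta> = map f \<rho>" "\<alpha> = map f \<gamma>"
    using assms by (metis Subst_eqE)
  obtain g where g: "\<beta> = map g \<rho>" "\<alpha> = map g \<gamma>'"
    using assms by (metis Subst_eqE)
  have "map f \<rho> = map g \<rho>"
    using f g by simp
  \<comment> \<open>Both renamings send \<rho> to \<beta>, so they agree on the letters of \<rho>,
    which are those of \<open>\<gamma>'\<close>.\<close>
  then have "map f \<gamma>' = map g \<gamma>'"
    using assms by simp
  then have "map f \<gamma> = map f \<gamma>'"
    using f(3) g(2) by metis
  then show ?thesis
    using f(1) assms by (metis inj_on_map_eq_map sup.idem)
qed

lemma preim_map:
  assumes "inj_on f (set \<gamma>)" "set s \<subseteq> set \<gamma>"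
  shows "preim (map f \<gamma>) (map f s) = map f (preim \<gamma> s)"
  unfolding preim_def filter_map
  by (intro arg_cong[of _ _ "map f"] filter_cong refl)
    (use inj_on_image_mem_iff[OF assms(1)] assms(2) in auto)

text \<open>The renaming \<open>f\<close> that carries the product term to the transpose of
  \<open>q\<close> also yields the cut: it cuts \<beta> into the images of \<rho> and
  \<open>\<rho>'\<close>, disjoint by injectivity.\<close>

lemma contributing_shuffle_imp_cut:
  assumes sets: "set \<rho> = set \<sigma>" "set \<rho>' = set \<sigma>'" "set \<sigma> \<inter> set \<sigma>' = {}" "set \<beta> = set \<alpha>"
    and \<gamma>: "\<gamma> \<in> shuffles \<sigma> \<sigma>'" "Subst (\<rho> @ \<rho>') \<gamma> = Subst \<beta> \<alpha>"
  shows "\<exists>(s, t)\<in>good_cuts \<beta>.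
    Subst \<rho> \<sigma> = Subst s (preim \<alpha> s) \<and> Subst \<rho>' \<sigma>' = Subst t (preim \<alpha> t)"
proof -
  have set_\<gamma>: "set \<gamma> = set \<sigma> \<union> set \<sigma>'"
    using \<gamma>(1) by (simp add: set_shuffles)
  then obtain f where f: "inj_on f (set \<gamma>)" "\<beta> = map f (\<rho> @ \<rho>')" "\<alpha> = map f \<gamma>"
    using \<gamma>(2) sets by (auto elim: Subst_eqE)
  have "f ` set \<rho> \<inter> f ` set \<rho>' = {}"
    using inj_on_image_Int[OF f(1), of "set \<rho>" "set \<rho>'"] set_\<gamma> sets by simp
  then have cut: "(map f \<rho>, map f \<rho>') \<in> good_cuts \<beta>"
    by (simp add: good_cuts_def f(2))
  \<comment> \<open>Filtering a shuffle of words with disjoint supports by the letters of one factor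
    returns that factor.\<close>
  have "preim \<gamma> \<rho> = \<sigma>" "preim \<gamma> \<rho>' = \<sigma>'"
    using filter_shuffles_disjoint1(1)[OF sets(3) \<gamma>(1)] filter_shuffles_disjoint2(1)[OF sets(3) \<gamma>(1)]
    by (simp_all add: preim_def sets)
  then have "preim \<alpha> (map f \<rho>) = map f \<sigma>" "preim \<alpha> (map f \<rho>') = map f \<sigma>'"
    using preim_map[OF f(1)] set_\<gamma> sets by (simp_all add: f(3))
  moreover have "inj_on f (set \<sigma>)" "inj_on f (set \<sigma>')"
    using f(1) set_\<gamma> by (auto intro: inj_on_subset)
  ultimately show ?thesis
    using cut sets by (intro bexI[OF _ cut]) (simp add: Subst_map)
qed

text \<open>The renamings of the two halves glue to one injective map, along which \<alpha>, a
  shuffle of its two restrictions, is pulled back to a shuffle of \<sigma> and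
  \<open>\<sigma>'\<close>.\<close>

lemma contributing_cut_imp_shuffle:
  assumes sets: "set \<rho> = set \<sigma>" "set \<rho>' = set \<sigma>'" "set \<sigma> \<inter> set \<sigma>' = {}" "set \<beta> = set \<alpha>"
    and st: "(s, t) \<in> good_cuts \<beta>"
      "Subst \<rho> \<sigma> = Subst s (preim \<alpha> s)" "Subst \<rho>' \<sigma>' = Subst t (preim \<alpha> t)"
  shows "\<exists>\<gamma>\<in>shuffles \<sigma> \<sigma>'. Subst (\<rho> @ \<rho>') \<gamma> = Subst \<beta> \<alpha>"
proof -
  have cut: "\<beta> = s @ t" "set s \<inter> set t = {}"
    using st(1) by (auto simp: good_cuts_def)
  then have sub: "set \<alpha> = set s \<union> set t"
    using sets(4) by simp
  obtain f where f: "inj_on f (set \<sigma>)" "s = map f \<rho>" "preim \<alpha> s = map f \<sigma>"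
    using st(2) sets(1) sub by (auto simp: set_preim elim: Subst_eqE)
  obtain g where g: "inj_on g (set \<sigma>')" "t = map g \<rho>'" "preim \<alpha> t = map g \<sigma>'"
    using st(3) sets(2) sub by (auto simp: set_preim elim: Subst_eqE)
  define h where "h a = (if a \<in> set \<sigma> then f a else g a)" for a
  have h1: "h a = f a" if "a \<in> set \<sigma>" for a
    using that by (simp add: h_def)
  have h2: "h a = g a" if "a \<in> set \<sigma>'" for a
    using that sets(3) by (auto simp: h_def)
  have maps: "s = map h \<rho>" "preim \<alpha> s = map h \<sigma>" "t = map h \<rho>'" "preim \<alpha> t = map h \<sigma>'"
    using f g h1 h2 sets by auto
  have "inj_on h (set \<sigma>)" "inj_on h (set \<sigma>')"
    using f(1) g(1) h1 h2 by (simp_all cong: inj_on_cong)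
  \<comment> \<open>The glued map stays injective because its two images are the supports of
    \<open>s\<close> and \<open>t\<close>, disjoint as the cut is good.\<close>
  moreover have "h ` set \<sigma> \<inter> h ` set \<sigma>' = {}"
    using cut(2) maps(1,3) sets by simp
  ultimately have inj: "inj_on h (set \<sigma> \<union> set \<sigma>')"
    by (auto simp: inj_on_Un)
  \<comment> \<open>Each letter of \<alpha> lies in exactly one of \<open>s\<close> and
    \<open>t\<close>, so the two restrictions are complementary filters.\<close>
  have "preim \<alpha> t = filter (\<lambda>a. a \<notin> set s) \<alpha>"
    unfolding preim_def using cut(2) sub by (intro filter_cong) auto
  then have "\<alpha> \<in> shuffles (preim \<alpha> s) (preim \<alpha> t)"
    using partition_in_shuffles[of \<alpha> "\<lambda>a. a \<in> set s"] by (simp add: preim_def)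
  then obtain \<gamma> where \<gamma>: "\<gamma> \<in> shuffles \<sigma> \<sigma>'" "\<alpha> = map h \<gamma>"
    unfolding maps(2,4) shuffles_map by auto
  have "set \<gamma> = set \<sigma> \<union> set \<sigma>'"
    using \<gamma>(1) by (simp add: set_shuffles)
  then have "Subst (map h (\<rho> @ \<rho>')) (map h \<gamma>) = Subst (\<rho> @ \<rho>') \<gamma>"
    using inj sets by (intro Subst_map) simp_all
  then show ?thesis
    using \<gamma> cut(1) maps(1,3) by auto
qed

theorem theorem6p10:
  fixes p p' q :: subst
  shows "dWHA_form (dWHA_mult (tensor (frag_of p) (frag_of p'))) (frag_of q) =
         dWHA2_form (tensor (frag_of p) (frag_of p')) (dWHA_comult (frag_of q))"
proof -
  obtain \<rho> \<sigma> \<rho>' \<sigma>' where sets: "set \<rho> = set \<sigma>" "set \<rho>' = set \<sigma>'" "set \<sigma> \<inter> set \<sigma>' = {}"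
    and p: "p = Subst \<rho> \<sigma>" "p' = Subst \<rho>' \<sigma>'"
    by (rule disjoint_representatives)
  obtain \<alpha> \<beta> where q: "set \<alpha> = set \<beta>" "q = Subst \<alpha> \<beta>"
    by (rule subst_cases)
  let ?P = "\<lambda>\<gamma>. Subst (\<rho> @ \<rho>') \<gamma> = Subst \<beta> \<alpha>"
  let ?Q = "\<lambda>(s, t). Subst \<rho> \<sigma> = Subst s (preim \<alpha> s) \<and> Subst \<rho>' \<sigma>' = Subst t (preim \<alpha> t)"
  have "dWHA_form (dWHA_mult (tensor (frag_of p) (frag_of p'))) (frag_of q) =
      (\<Sum>\<gamma>\<in>shuffles \<sigma> \<sigma>'. if ?P \<gamma> then 1 else 0)"
    using sets q(1)
    by (simp add: dWHA_form_def dWHA_mult_def tensor_def frag_extend_of p q(2) mult_basis_Subst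
        shuffle_product_disjoint bilinear_extend_sum_left form_basis_Subst
        flip: sum_unfold_sum_mset)
  also have "\<dots> = (if \<exists>\<gamma>\<in>shuffles \<sigma> \<sigma>'. ?P \<gamma> then 1 else 0)"
    using sets q(1)
    by (intro sum_unique_indicator) (auto intro: contributing_shuffle_unique simp: set_shuffles)
  also have "(\<exists>\<gamma>\<in>shuffles \<sigma> \<sigma>'. ?P \<gamma>) \<longleftrightarrow> (\<exists>c\<in>good_cuts \<beta>. ?Q c)"
    using contributing_shuffle_imp_cut[OF sets q(1)[symmetric]]
      contributing_cut_imp_shuffle[OF sets q(1)[symmetric]] by fast
  also have "(if \<exists>c\<in>good_cuts \<beta>. ?Q c then 1 else 0) =
      (\<Sum>c\<in>good_cuts \<beta>. if ?Q c then 1 else 0 :: int)"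
  proof (rule sum_unique_indicator[symmetric])
    \<comment> \<open>Renaming preserves length, and a cut of \<beta> is determined by the length of
      its first part.\<close>
    have len: "length s = length \<rho>" if "(s, t) \<in> good_cuts \<beta>" "?Q (s, t)" for s t
    proof -
      have "set (preim \<alpha> s) = set s"
        using that(1) q(1) by (intro set_preim) (auto simp: good_cuts_def)
      then show ?thesis
        using that(2) sets(1) by (auto elim: Subst_eqE)
    qed
    fix c d assume cd: "c \<in> good_cuts \<beta>" "d \<in> good_cuts \<beta>" "?Q c" "?Q d"
    obtain s t s' t' where st: "c = (s, t)" "d = (s', t')"
      by (metis surj_pair)
    have "length s = length s'"
      using len[of s t] len[of s' t'] cd by (simp add: st)
    then show "c = d"
      using cd(1,2) by (auto simp: st good_cuts_def)
  qed simp
  also have "\<dots> = dWHA2_form (tensor (frag_of p) (frag_of p')) (dWHA_comult (frag_of q))"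
  proof -
    \<comment> \<open>In each half of the cut \<open>preim\<close> is the upper word; the form
      transposes it into the shape of \<open>?Q\<close>, and the product of two indicators is that
      of the conjunction.\<close>
    have "(if ?Q (s, t) then 1 else 0) =
        form_basis p (Subst (preim \<alpha> s) s) * form_basis p' (Subst (preim \<alpha> t) t)"
      if "(s, t) \<in> good_cuts \<beta>" for s t
    proof -
      have "set s \<subseteq> set \<alpha>" "set t \<subseteq> set \<alpha>"
        using that q(1) by (auto simp: good_cuts_def)
      then show ?thesis
        by (simp add: form_basis_Subst set_preim p)
    qed
    then show ?thesis
      using q(1)
      by (auto simp: dWHA2_form_def dWHA_comult_def tensor_def frag_extend_of q(2)
          comult_basis_Subst bilinear_extend_sum_right split_def intro!: sum.cong)
  qed
  finally show ?thesis .
qed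

end
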